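(* Let $\nu\ge2$ and $g\ge1$ be integers, $c_\nu=2\nu\binom{2\nu-1}{\nu-1}$, and let $z_0(s),z_1(s),\dots$ be the coefficients of the large-$k$ expansion of $b_k^2/k$ (see context). Then: (1) $z_g$ is of class iir in $z_0$, with singularities only possible at $z_0=0$ and $z_0=\nu/(\nu-1)$. (2) $z_g$ is given as a function of $z_0$ by $$z_g(s)=\frac{z_0(s)^{2(1-g)}}{\nu-(\nu-1)z_0(s)}\int_1^{z_0(s)}\frac{\nu-(\nu-1)y}{c_\nu\,y^{\nu+3-2g}}\,\mathrm{Forcing}_g(y)\,dy .$$ (3) In this formula $\mathrm{Forcing}_g$ (evaluated at $w=1$), a priori a function of many arguments, is a function of $z_0(s)$ alone, denoted $\mathrm{Forcing}_g(z_0)$.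
   Context: For $\xi\le0$, $b_k(\xi)>0$ are the recurrence coefficients $\lambda p_n=b_{n+1}p_{n+1}+b_np_{n-1}$ of the orthonormal polynomials for the weight $\exp(-\tfrac12\lambda^2+2\xi\lambda^{2\nu})d\lambda$ on $\mathbb R$ (so $b_k(0)^2=k$). With $s=2k^{\nu-1}\xi\le0$ fixed, as $k\to\infty$ one has the asymptotic expansion $b_k^2\simeq k\sum_{g\ge0}z_g(s)k^{-2g}$, where the $z_g$ are analytic near $s=0$, $z_0(0)=1$, $z_g(0)=0$ for $g\ge1$. The function $z_0(s)$ is the solution, regular at $s=0$, of $1=z_0-c_\nu s z_0^\nu$. Put $f_g(s,w)=w^{1-2g}z_g(w^{\nu-1}s)$ and $f=\sum_{g\ge0}k^{-2g}f_g$ (formal series in $k^{-2}$). For $\ell\ge1$ define the differential polynomial $F_\ell^{(\nu)}$ in $f$ and its $w$-derivatives as the coefficient of $\epsilon^{2\ell+1}$ in the formal Taylor expansion in $\epsilon$ of $$\sum_{1\le j_1<\cdots<j_{\nu+1}\le2\nu}\Bigl[\prod_{m=1}^{\nu+1}f(w+\epsilon(\ell_m+1))-\prod_{m=1}^{\nu+1}f(w+\epsilon\ell_m)\Bigr],\qquad \ell_m=j_m-2m+1 .$$ Let $F_\ell^{(\nu)}[2r]$ be the coefficient of $k^{-2r}$ in $F_\ell^{(\nu)}$ when the formal series $f$ is inserted. Then $$\mathrm{Forcing}_g=\frac{c_\nu}{\nu+1}\frac{\partial}{\partial w}\sum_{\substack{0\le i_j<g\\ i_1+\cdots+i_{\nu+1}=g}}f_{i_1}\cdots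 f_{i_{\nu+1}}+F_1^{(\nu)}[2g-2]+F_2^{(\nu)}[2g-4]+\cdots+F_g^{(\nu)}[0],$$ which is evaluated at $w=1$ and depends only on $s$, $z_j$ with $j<g$, and their $s$-derivatives. The $g$-th equation of the hierarchy, solved by $z_g$, is $z_g'(s)=c_\nu\bigl(f_0^\nu\,\partial_wf_g+\nu f_0^{\nu-1}f_g\,\partial_wf_0\bigr)\big|_{w=1}+\mathrm{Forcing}_g|_{w=1}$. Class iir (iterated integrals of rational functions): let $R$ be the ring of rational functions of $z$ whose poles lie in $\{0,\nu/(\nu-1)\}$. Set $A_0=R$, and inductively let $A_{n+1}$ be the ring of polynomials, with coefficients in $R$, in elements of $A_n$ and in antiderivatives with respect to $dz$ of elements of $A_n$. A function of $z=z_0$ (near $z_0=1$) is of class iir if it belongs to some $A_n$. *)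

theory Defs
  imports
    "HOL-Complex_Analysis.Complex_Analysis"
    "HOL-Computational_Algebra.Computational_Algebra"
    "HOL-Library.FuncSet"
    "HOL-Library.Landau_Symbols"
begin

section \<open>Recurrence coefficients and their asymptotic expansion\<close>

definition weight :: "nat \<Rightarrow> real \<Rightarrow> real \<Rightarrow> real" where
  "weight \<nu> \<xi> x = exp (- (x ^ 2) / 2 + 2 * \<xi> * x ^ (2 * \<nu>))"

definition orthonormal_polys :: "nat \<Rightarrow> real \<Rightarrow> (nat \<Rightarrow> real poly) \<Rightarrow> bool" where
  "orthonormal_polys \<nu> \<xi> p \<longleftrightarrow>
     (\<forall>n. degree (p n) = n) \<and>
     (\<forall>m n. (LINT x|lborel. poly (p m) x * poly (p n) x * weight \<nu> \<xi> x)
             = (if m = n then 1 else 0))"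

text \<open>The value \<open>b 0\<close> is irrelevant, since \<open>p\<^sub>-\<^sub>1 = 0\<close>. Positivity of the
  \<open>b k\<close> fixes the signs of the \<open>p n\<close> up to a common factor.\<close>

definition recurrence_coeffs :: "nat \<Rightarrow> real \<Rightarrow> (nat \<Rightarrow> real) \<Rightarrow> bool" where
  "recurrence_coeffs \<nu> \<xi> b \<longleftrightarrow>
     (\<forall>k\<ge>1. b k > 0) \<and>
     (\<exists>p. orthonormal_polys \<nu> \<xi> p \<and>
          [:0, 1:] * p 0 = smult (b 1) (p 1) \<and>
          (\<forall>n\<ge>1. [:0, 1:] * p n = smult (b (n + 1)) (p (n + 1)) + smult (b n) (p (n - 1))))"

text \<open>\<open>b \<xi> k\<close> is the \<open>k\<close>-th recurrence coefficient at parameter \<open>\<xi>\<close>. The expansion is in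
  the sense of Poincare, with \<open>s = 2 k\<^sup>\<nu>\<^sup>-\<^sup>1 \<xi>\<close> kept fixed.\<close>

definition has_expansion_at ::
    "nat \<Rightarrow> (real \<Rightarrow> nat \<Rightarrow> real) \<Rightarrow> (nat \<Rightarrow> complex \<Rightarrow> complex) \<Rightarrow> real \<Rightarrow> bool" where
  "has_expansion_at \<nu> b z s \<longleftrightarrow>
     (\<forall>N. (\<lambda>k. complex_of_real ((b (s / (2 * real k ^ (\<nu> - 1))) k)\<^sup>2)
                - of_nat k * (\<Sum>g\<le>N. z g (of_real s) / of_nat k ^ (2 * g)))
          \<in> o(\<lambda>k. of_nat k * (1 / of_nat k ^ (2 * N))))"

definition c_const :: "nat \<Rightarrow> complex" where
  "c_const \<nu> = of_nat (2 * \<nu> * ((2 * \<nu> - 1) choose (\<nu> - 1)))"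


section \<open>The hierarchy\<close>

definition f_coeff :: "nat \<Rightarrow> (nat \<Rightarrow> complex \<Rightarrow> complex) \<Rightarrow> nat \<Rightarrow> complex \<Rightarrow> complex \<Rightarrow> complex" where
  "f_coeff \<nu> z g s w = w powi (1 - 2 * int g) * z g (w ^ (\<nu> - 1) * s)"

text \<open>Formal series in \<open>k\<^sup>-\<^sup>2\<close> have type \<^typ>\<open>complex fps\<close>; formal series in \<open>\<epsilon>\<close> over these have
  type \<^typ>\<open>complex fps fps\<close>. \<open>f_jet \<nu> z s w n\<close> is the \<open>n\<close>-th \<open>w\<close>-derivative of the
  series \<open>f\<close>, taken coefficientwise in \<open>k\<^sup>-\<^sup>2\<close>.\<close>

definition f_jet :: "nat \<Rightarrow> (nat \<Rightarrow> complex \<Rightarrow> complex) \<Rightarrow> complex \<Rightarrow> complex \<Rightarrow> nat \<Rightarrow> complex fps" where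
  "f_jet \<nu> z s w n = Abs_fps (\<lambda>r. (deriv ^^ n) (f_coeff \<nu> z r s) w)"

text \<open>Formal Taylor expansion in \<open>\<epsilon>\<close> of \<open>f (w + \<epsilon> a)\<close>, where \<open>u n\<close> stands for the \<open>n\<close>-th
  derivative of \<open>f\<close> at \<open>w\<close>.\<close>

definition taylor_shift :: "(nat \<Rightarrow> complex fps) \<Rightarrow> int \<Rightarrow> complex fps fps" where
  "taylor_shift u a = Abs_fps (\<lambda>n. fps_const (of_int a ^ n / fact n) * u n)"

definition walk_indices :: "nat \<Rightarrow> (nat \<Rightarrow> nat) set" where
  "walk_indices \<nu> = {j \<in> {1..\<nu> + 1} \<rightarrow>\<^sub>E {1..2 * \<nu>}. strict_mono_on {1..\<nu> + 1} j}"

definition walk_level :: "(nat \<Rightarrow> nat) \<Rightarrow> nat \<Rightarrow> int" where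
  "walk_level j m = int (j m) - 2 * int m + 1"

definition F_poly :: "nat \<Rightarrow> nat \<Rightarrow> (nat \<Rightarrow> complex fps) \<Rightarrow> complex fps" where
  "F_poly \<nu> l u = fps_nth
     (\<Sum>j\<in>walk_indices \<nu>.
        (\<Prod>m = 1..\<nu> + 1. taylor_shift u (walk_level j m + 1))
      - (\<Prod>m = 1..\<nu> + 1. taylor_shift u (walk_level j m))) (2 * l + 1)"

text \<open>The coefficient of \<open>k\<^sup>-\<^sup>2\<^sup>r\<close> in \<open>F_poly \<nu> l\<close> at the series \<open>f\<close>.\<close>

definition F_coeff ::
    "nat \<Rightarrow> (nat \<Rightarrow> complex \<Rightarrow> complex) \<Rightarrow> nat \<Rightarrow> nat \<Rightarrow> complex \<Rightarrow> complex \<Rightarrow> complex" where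
  "F_coeff \<nu> z l r s w = fps_nth (F_poly \<nu> l (f_jet \<nu> z s w)) r"

definition lower_indices :: "nat \<Rightarrow> nat \<Rightarrow> (nat \<Rightarrow> nat) set" where
  "lower_indices \<nu> g = {i \<in> {1..\<nu> + 1} \<rightarrow>\<^sub>E {0..<g}. (\<Sum>m = 1..\<nu> + 1. i m) = g}"

definition Forcing ::
    "nat \<Rightarrow> (nat \<Rightarrow> complex \<Rightarrow> complex) \<Rightarrow> nat \<Rightarrow> complex \<Rightarrow> complex \<Rightarrow> complex" where
  "Forcing \<nu> z g s w =
     c_const \<nu> / of_nat (\<nu> + 1)
       * deriv (\<lambda>w. \<Sum>i\<in>lower_indices \<nu> g. \<Prod>m = 1..\<nu> + 1. f_coeff \<nu> z (i m) s w) w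
     + (\<Sum>l = 1..g. F_coeff \<nu> z l (g - l) s w)"

definition hierarchy_eq :: "nat \<Rightarrow> (nat \<Rightarrow> complex \<Rightarrow> complex) \<Rightarrow> nat \<Rightarrow> complex \<Rightarrow> bool" where
  "hierarchy_eq \<nu> z g s \<longleftrightarrow>
     deriv (z g) s =
       c_const \<nu> * (f_coeff \<nu> z 0 s 1 ^ \<nu> * deriv (f_coeff \<nu> z g s) 1
                    + of_nat \<nu> * f_coeff \<nu> z 0 s 1 ^ (\<nu> - 1) * f_coeff \<nu> z g s 1
                      * deriv (f_coeff \<nu> z 0 s) 1)
       + Forcing \<nu> z g s 1"


section \<open>Iterated integrals of rational functions\<close>

definition sing_points :: "nat \<Rightarrow> complex set" where
  "sing_points \<nu> = {0, of_nat \<nu> / of_nat (\<nu> - 1)}"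

text \<open>Only the germs at \<open>1\<close> of the following functions matter; all sets below are closed
  under equality near \<open>1\<close>. A denominator without roots outside \<open>sing_points \<nu>\<close> is
  in particular nonzero.\<close>

definition rat_funs :: "nat \<Rightarrow> (complex \<Rightarrow> complex) set" where
  "rat_funs \<nu> = {f. \<exists>p q. (\<forall>x. poly q x = 0 \<longrightarrow> x \<in> sing_points \<nu>) \<and>
                        (\<forall>\<^sub>F x in nhds 1. f x = poly p x / poly q x)}"

definition antiderivs :: "(complex \<Rightarrow> complex) set \<Rightarrow> (complex \<Rightarrow> complex) set" where
  "antiderivs A = {F. \<exists>f\<in>A. \<forall>\<^sub>F x in nhds 1. (F has_field_derivative f x) (at x)}"

text \<open>Polynomials with coefficients in \<open>R\<close> in elements of \<open>G\<close>.\<close>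

inductive_set poly_ring ::
    "(complex \<Rightarrow> complex) set \<Rightarrow> (complex \<Rightarrow> complex) set \<Rightarrow> (complex \<Rightarrow> complex) set"
  for R G where
  coefficient: "f \<in> R \<Longrightarrow> f \<in> poly_ring R G"
| generator: "f \<in> G \<Longrightarrow> f \<in> poly_ring R G"
| add: "f \<in> poly_ring R G \<Longrightarrow> h \<in> poly_ring R G \<Longrightarrow> (\<lambda>x. f x + h x) \<in> poly_ring R G"
| mult: "f \<in> poly_ring R G \<Longrightarrow> h \<in> poly_ring R G \<Longrightarrow> (\<lambda>x. f x * h x) \<in> poly_ring R G"

primrec iir_level :: "nat \<Rightarrow> nat \<Rightarrow> (complex \<Rightarrow> complex) set" where
  "iir_level \<nu> 0 = rat_funs \<nu>"
| "iir_level \<nu> (Suc n) = poly_ring (rat_funs \<nu>) (iir_level \<nu> n \<union> antiderivs (iir_level \<nu> n))"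

definition iir :: "nat \<Rightarrow> (complex \<Rightarrow> complex) \<Rightarrow> bool" where
  "iir \<nu> f \<longleftrightarrow> (\<exists>n. f \<in> iir_level \<nu> n)"

text \<open>Analytic continuation of the germ of \<open>f\<close> at \<open>\<gamma> 0\<close> along the path \<open>\<gamma>\<close>;
  \<open>h t\<close> represents the continued germ at \<open>\<gamma> t\<close>.\<close>

definition continuable_along :: "(complex \<Rightarrow> complex) \<Rightarrow> (real \<Rightarrow> complex) \<Rightarrow> bool" where
  "continuable_along f \<gamma> \<longleftrightarrow>
     (\<exists>h :: real \<Rightarrow> complex \<Rightarrow> complex.
        (\<forall>\<^sub>F x in nhds (\<gamma> 0). h 0 x = f x) \<and>
        (\<forall>t\<in>{0..1}. h t analytic_on {\<gamma> t} \<and>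
           (\<forall>\<^sub>F t' in at t within {0..1}. \<forall>\<^sub>F x in nhds (\<gamma> t'). h t' x = h t x)))"

text \<open>The (possibly multivalued) function given by the germ of \<open>f\<close> at \<open>1\<close> has no finite
  singularities outside \<open>S\<close>.\<close>

definition singular_only_at :: "complex set \<Rightarrow> (complex \<Rightarrow> complex) \<Rightarrow> bool" where
  "singular_only_at S f \<longleftrightarrow>
     (\<forall>\<gamma>. path \<gamma> \<and> pathstart \<gamma> = 1 \<and> path_image \<gamma> \<inter> S = {} \<longrightarrow> continuable_along f \<gamma>)"

end

theory Submission
  imports Defs
begin

text \<open>Differentiating the string equation gives \<open>dz\<^sub>0/ds = c z\<^sub>0\<^bsup>\<nu>+1\<^esup> / D\<close> with
  \<open>D = \<nu> - (\<nu> - 1) z\<^sub>0\<close>, so in the variable \<open>z\<^sub>0\<close> the \<open>g\<close>-th equation of the hierarchy is a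
  linear first-order equation for \<open>z\<^sub>g\<close> with integrating factor \<open>D z\<^sub>0\<^bsup>2g-2\<^esup>\<close>, and \<open>z\<^sub>g(0) = 0\<close>
  selects the solution vanishing at \<open>z\<^sub>0 = 1\<close>. By homogeneity of the \<open>f\<^sub>r\<close> in \<open>w\<close>, the operator
  \<open>w \<partial>/\<partial>w\<close> acts through \<open>s d/ds\<close>, which is \<open>z\<^sub>0 (z\<^sub>0 - 1) / D d/dz\<^sub>0\<close>. Class iir is closed under
  this operator, so inductively \<open>Forcing\<^sub>g\<close>, and with it \<open>z\<^sub>g\<close>, is of class iir in \<open>z\<^sub>0\<close>.\<close>

lemma holomorphic_on_derivI:
  assumes "\<And>x. x \<in> S \<Longrightarrow> (f has_field_derivative f' x) (at x)"
  shows "f holomorphic_on S"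
  unfolding holomorphic_on_def field_differentiable_def
  using assms has_field_derivative_at_within by blast

section \<open>Closure properties of class iir\<close>

lemma one_notin_sing_points: "\<nu> \<ge> 2 \<Longrightarrow> 1 \<notin> sing_points \<nu>"
proof
  assume nu: "\<nu> \<ge> 2" and "1 \<in> sing_points \<nu>"
  then have "(of_nat (\<nu> - 1) :: complex) = of_nat \<nu>"
    by (simp add: sing_points_def eq_divide_eq del: of_nat_diff)
  then have "\<nu> - 1 = \<nu>" unfolding of_nat_eq_iff .
  with nu show False by simp
qed

lemma rat_funs_eventually_denom_nonzero:
  assumes "\<nu> \<ge> 2" and "\<forall>x. poly q x = 0 \<longrightarrow> x \<in> sing_points \<nu>"
  shows "\<forall>\<^sub>F x in nhds 1. poly q x \<noteq> 0"
proof -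
  have "open (- sing_points \<nu>)"
    by (intro open_Compl finite_imp_closed) (simp add: sing_points_def)
  moreover have "1 \<in> - sing_points \<nu>"
    using one_notin_sing_points assms(1) by simp
  ultimately have "\<forall>\<^sub>F x in nhds 1. x \<in> - sing_points \<nu>"
    by (rule eventually_nhds_in_open)
  then show ?thesis
    by eventually_elim (use assms(2) in auto)
qed

section \<open>Levels of the class, ring operations, and induction over the class\<close>

lemma iir_level_mono: "m \<le> n \<Longrightarrow> iir_level \<nu> m \<subseteq> iir_level \<nu> n"
proof (rule lift_Suc_mono_le[of "iir_level \<nu>"])
  show "iir_level \<nu> k \<subseteq> iir_level \<nu> (Suc k)" for k
    unfolding iir_level.simps(2) by (rule subsetI, rule poly_ring.generator) simp
qed

lemma iir_rat: "f \<in> rat_funs \<nu> \<Longrightarrow> iir \<nu> f"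
  unfolding iir_def by (rule exI[of _ 0]) simp

lemma iir_obtain_common_level:
  assumes "iir \<nu> f" "iir \<nu> h"
  obtains n where "f \<in> iir_level \<nu> n" "h \<in> iir_level \<nu> n"
proof -
  from assms obtain m n where "f \<in> iir_level \<nu> m" "h \<in> iir_level \<nu> n"
    by (auto simp: iir_def)
  then have "f \<in> iir_level \<nu> (max m n)" "h \<in> iir_level \<nu> (max m n)"
    by (auto intro: subsetD[OF iir_level_mono[of m "max m n"]] subsetD[OF iir_level_mono[of n "max m n"]])
  then show thesis by (rule that)
qed

lemma iir_add:
  assumes "iir \<nu> f" "iir \<nu> h"
  shows "iir \<nu> (\<lambda>x. f x + h x)"
proof -
  obtain n where "f \<in> iir_level \<nu> n" "h \<in> iir_level \<nu> n"
    using iir_obtain_common_level[OF assms] .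
  then have "(\<lambda>x. f x + h x) \<in> iir_level \<nu> (Suc n)"
    unfolding iir_level.simps by (intro poly_ring.add; intro poly_ring.generator; simp)
  then show ?thesis unfolding iir_def by blast
qed

lemma iir_mult:
  assumes "iir \<nu> f" "iir \<nu> h"
  shows "iir \<nu> (\<lambda>x. f x * h x)"
proof -
  obtain n where "f \<in> iir_level \<nu> n" "h \<in> iir_level \<nu> n"
    using iir_obtain_common_level[OF assms] .
  then have "(\<lambda>x. f x * h x) \<in> iir_level \<nu> (Suc n)"
    unfolding iir_level.simps by (intro poly_ring.mult; intro poly_ring.generator; simp)
  then show ?thesis unfolding iir_def by blast
qed

lemma iir_antideriv:
  assumes "iir \<nu> f" "\<forall>\<^sub>F x in nhds 1. (F has_field_derivative f x) (at x)"
  shows "iir \<nu> F"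
proof -
  from assms(1) obtain n where "f \<in> iir_level \<nu> n" by (auto simp: iir_def)
  then have "F \<in> iir_level \<nu> (Suc n)"
    using assms(2) by (auto simp: antiderivs_def intro!: poly_ring.generator)
  then show ?thesis unfolding iir_def by blast
qed

text \<open>Nests an induction over the construction of \<open>poly_ring\<close> in one over the
  level, so that later arguments see neither. The hypotheses also provide membership of the parts,
  which is why the inner claim carries \<open>iir \<nu> f\<close> along with
  \<open>P f\<close>.\<close>

lemma iir_induct [consumes 1, case_names rat add mult antideriv]:
  assumes "iir \<nu> f"
    and rat: "\<And>f. f \<in> rat_funs \<nu> \<Longrightarrow> P f"
    and add: "\<And>f h. iir \<nu> f \<Longrightarrow> P f \<Longrightarrow> iir \<nu> h \<Longrightarrow> P h \<Longrightarrow> P (\<lambda>x. f x + h x)"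
    and mult: "\<And>f h. iir \<nu> f \<Longrightarrow> P f \<Longrightarrow> iir \<nu> h \<Longrightarrow> P h \<Longrightarrow> P (\<lambda>x. f x * h x)"
    and antideriv: "\<And>f F. iir \<nu> f \<Longrightarrow> P f \<Longrightarrow>
      \<forall>\<^sub>F x in nhds 1. (F has_field_derivative f x) (at x) \<Longrightarrow> P F"
  shows "P f"
proof -
  from assms(1) obtain n where "f \<in> iir_level \<nu> n" by (auto simp: iir_def)
  then show ?thesis
  proof (induction n arbitrary: f)
    case 0
    then show ?case using rat by simp
  next
    case (Suc n)
    have lev: "iir \<nu> h" if "h \<in> iir_level \<nu> n" for h
      using that unfolding iir_def by blast
    from Suc.prems have "f \<in> poly_ring (rat_funs \<nu>) (iir_level \<nu> n \<union> antiderivs (iir_level \<nu> n))"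
      by simp
    then have "iir \<nu> f \<and> P f"
    proof induction
      case (coefficient f)
      then show ?case using rat[of f] iir_rat[of f] by simp
    next
      case (generator f)
      then consider "f \<in> iir_level \<nu> n" | h where "h \<in> iir_level \<nu> n"
        "\<forall>\<^sub>F x in nhds 1. (f has_field_derivative h x) (at x)"
        by (auto simp: antiderivs_def)
      then show ?case
      proof cases
        case 1
        then show ?thesis using Suc.IH lev by simp
      next
        case (2 h)
        then show ?thesis
          using antideriv[OF lev[OF 2(1)] Suc.IH[OF 2(1)] 2(2)]
            iir_antideriv[OF lev[OF 2(1)] 2(2)] by simp
      qed
    next
      case (add f h)
      then show ?case using assms(3)[of f h] iir_add[of \<nu> f h] by simp
    next
      case (mult f h)
      then show ?case using assms(4)[of f h] iir_mult[of \<nu> f h] by simp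
    qed
    then show ?case ..
  qed
qed

section \<open>Basic members of the class; differentiation and integration inside it\<close>

lemma iir_const: "iir \<nu> (\<lambda>_. c)"
  by (rule iir_rat, unfold rat_funs_def, rule CollectI, rule exI[of _ "[:c:]"], rule exI[of _ 1]) simp

lemma iir_ident: "iir \<nu> (\<lambda>x. x)"
  by (rule iir_rat, unfold rat_funs_def, rule CollectI, rule exI[of _ "[:0, 1:]"], rule exI[of _ 1]) simp

lemma iir_inverse_ident: "iir \<nu> inverse"
  by (rule iir_rat, unfold rat_funs_def, rule CollectI, rule exI[of _ 1], rule exI[of _ "[:0, 1:]"])
    (simp add: sing_points_def field_simps)

text \<open>The root of the denominator is \<nu>/(\<nu> - 1), the second admissible pole.\<close>

lemma iir_inverse_linear:
  assumes "\<nu> \<ge> 2"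
  shows "iir \<nu> (\<lambda>x. inverse (of_nat \<nu> - of_nat (\<nu> - 1) * x))"
proof -
  have "x \<in> sing_points \<nu>" if "poly [:of_nat \<nu>, - of_nat (\<nu> - 1):] x = 0" for x :: complex
  proof -
    have "of_nat (\<nu> - 1) \<noteq> (0 :: complex)" using assms by simp
    moreover have "x * of_nat (\<nu> - 1) = of_nat \<nu>" using that by simp
    ultimately show ?thesis by (simp add: sing_points_def eq_divide_eq del: of_nat_diff)
  qed
  then show ?thesis
    by (intro iir_rat, unfold rat_funs_def, intro CollectI, rule_tac exI[of _ 1],
        rule_tac exI[of _ "[:of_nat \<nu>, - of_nat (\<nu> - 1):]"])
      (simp add: inverse_eq_divide mult.commute del: of_nat_diff)
qed

lemma iir_power: "iir \<nu> f \<Longrightarrow> iir \<nu> (\<lambda>x. f x ^ n)"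
  by (induction n) (auto intro: iir_const iir_mult)

lemma iir_power_int_ident: "iir \<nu> (\<lambda>x. x powi k)"
  using iir_power[OF iir_ident, of \<nu> "nat k"] iir_power[OF iir_inverse_ident, of \<nu> "nat (- k)"]
  by (cases "0 \<le> k") (simp_all add: power_int_def)

text \<open>The quotient rule replaces the denominator \<open>q\<close> by \<open>q * q\<close>,
  which has the same roots, so no new poles arise. An antiderivative gives back its integrand,
  already a member of the class.\<close>

lemma iir_deriv:
  assumes "\<nu> \<ge> 2" "iir \<nu> f"
  obtains f' where "iir \<nu> f'" "\<forall>\<^sub>F x in nhds 1. (f has_field_derivative f' x) (at x)"
proof -
  from assms(2) have "\<exists>f'. iir \<nu> f' \<and> (\<forall>\<^sub>F x in nhds 1. (f has_field_derivative f' x) (at x))"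
  proof (induction rule: iir_induct)
    case (rat f)
    then obtain p q where q: "\<forall>x. poly q x = 0 \<longrightarrow> x \<in> sing_points \<nu>"
      and f: "\<forall>\<^sub>F x in nhds 1. f x = poly p x / poly q x"
      by (auto simp: rat_funs_def)
    define f' where "f' = (\<lambda>x. poly (pderiv p * q - p * pderiv q) x / poly (q * q) x)"
    have "iir \<nu> f'"
      by (rule iir_rat, unfold rat_funs_def f'_def, rule CollectI,
          rule exI[of _ "pderiv p * q - p * pderiv q"], rule exI[of _ "q * q"]) (use q in auto)
    \<comment> \<open>\<open>f\<close> is a quotient only near 1; differentiating at a nearby
      \<open>x\<close> needs the equality near \<open>x\<close>, which
      \<open>eventually_eventually\<close> supplies.\<close>
    moreover have "\<forall>\<^sub>F x in nhds 1. (f has_field_derivative f' x) (at x)"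
      using rat_funs_eventually_denom_nonzero[OF assms(1) q] eventually_eventually[THEN iffD2, OF f]
    proof eventually_elim
      case (elim x)
      have "((\<lambda>x. poly p x / poly q x) has_field_derivative f' x) (at x)"
        unfolding f'_def using DERIV_divide[OF poly_DERIV[of p x] poly_DERIV[of q x] elim(1)]
        by (simp add: mult.commute)
      then show ?case
        unfolding DERIV_cong_ev[OF refl elim(2) refl] .
    qed
    ultimately show ?case by (intro exI[of _ f'] conjI)
  next
    case (add f h)
    obtain f' where "iir \<nu> f'" and ev: "\<forall>\<^sub>F x in nhds 1. (f has_field_derivative f' x) (at x)"
      using add(3) by (elim exE conjE)
    moreover obtain h' where "iir \<nu> h'"
      and ev': "\<forall>\<^sub>F x in nhds 1. (h has_field_derivative h' x) (at x)"
      using add(4) by (elim exE conjE)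
    ultimately have "iir \<nu> (\<lambda>x. f' x + h' x)" by (intro iir_add)
    moreover have "\<forall>\<^sub>F x in nhds 1. ((\<lambda>x. f x + h x) has_field_derivative (f' x + h' x)) (at x)"
      using ev ev' by eventually_elim (rule DERIV_add)
    ultimately show ?case by (intro exI[of _ "\<lambda>x. f' x + h' x"] conjI)
  next
    case (mult f h)
    obtain f' where "iir \<nu> f'" and ev: "\<forall>\<^sub>F x in nhds 1. (f has_field_derivative f' x) (at x)"
      using mult(3) by (elim exE conjE)
    moreover obtain h' where "iir \<nu> h'"
      and ev': "\<forall>\<^sub>F x in nhds 1. (h has_field_derivative h' x) (at x)"
      using mult(4) by (elim exE conjE)
    ultimately have "iir \<nu> (\<lambda>x. f' x * h x + h' x * f x)"
      using mult(1,2) by (intro iir_add iir_mult)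
    moreover have "\<forall>\<^sub>F x in nhds 1.
        ((\<lambda>x. f x * h x) has_field_derivative (f' x * h x + h' x * f x)) (at x)"
      using ev ev' by eventually_elim (rule DERIV_mult)
    ultimately show ?case by (intro exI[of _ "\<lambda>x. f' x * h x + h' x * f x"] conjI)
  next
    case (antideriv f F)
    then show ?case by (intro exI[of _ f] conjI)
  qed
  then show thesis by (elim exE conjE that)
qed

text \<open>\<open>iir_deriv\<close> makes \<open>f\<close> holomorphic on a disc around 1, and a
  disc is convex, so a primitive exists. Its normalisation matches the lower limit 1 of the integral
  in the final formula.\<close>

lemma iir_has_antideriv:
  assumes "\<nu> \<ge> 2" "iir \<nu> f"
  obtains F e where "iir \<nu> F" "e > 0" "F 1 = 0"
    "\<And>x. x \<in> ball 1 e \<Longrightarrow> (F has_field_derivative f x) (at x)"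
proof -
  obtain f' where "\<forall>\<^sub>F x in nhds 1. (f has_field_derivative f' x) (at x)"
    using iir_deriv[OF assms] .
  then obtain e where e: "e > 0" "\<And>x. x \<in> ball 1 e \<Longrightarrow> (f has_field_derivative f' x) (at x)"
    by (auto simp: eventually_nhds_metric dist_commute)
  have hol: "f holomorphic_on ball 1 e"
    using e(2) by (rule holomorphic_on_derivI)
  then obtain G where G: "\<And>x. x \<in> ball 1 e \<Longrightarrow> (G has_field_derivative f x) (at x within ball 1 e)"
    using holomorphic_convex_primitive'[of "ball 1 e" f] by auto
  define F where "F = (\<lambda>x. G x - G 1)"
  have F: "(F has_field_derivative f x) (at x)" if "x \<in> ball 1 e" for x
    using G[OF that] that unfolding F_def at_within_open[OF that open_ball]
    by (auto intro!: derivative_eq_intros)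
  moreover have "iir \<nu> F"
    by (rule iir_antideriv[OF assms(2)], rule eventually_mono[OF eventually_nhds_in_open[of "ball 1 e"]])
      (use e F in auto)
  ultimately show thesis using that[of F e] e by (simp add: F_def)
qed

section \<open>Analytic continuation\<close>

text \<open>The difference is constant on a small disc. This serves both to match primitives when
  they are glued and as the uniqueness argument that identifies \<open>z g\<close>.\<close>

lemma eventually_eq_if_same_deriv:
  fixes f g :: "complex \<Rightarrow> complex"
  assumes "\<forall>\<^sub>F x in nhds a. (f has_field_derivative d x) (at x)"
    and "\<forall>\<^sub>F x in nhds a. (g has_field_derivative d x) (at x)" and "f a = g a"
  shows "\<forall>\<^sub>F x in nhds a. f x = g x"
proof -
  from assms(1,2) have "\<forall>\<^sub>F x in nhds a. ((\<lambda>x. f x - g x) has_field_derivative 0) (at x)"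
    by eventually_elim (auto intro!: derivative_eq_intros)
  then obtain e where e: "e > 0" "\<And>x. x \<in> ball a e \<Longrightarrow> ((\<lambda>x. f x - g x) has_field_derivative 0) (at x)"
    by (auto simp: eventually_nhds_metric dist_commute)
  then obtain C where "\<And>x. x \<in> ball a e \<Longrightarrow> f x - g x = C"
    using has_field_derivative_zero_constant[of "ball a e" "\<lambda>x. f x - g x"]
    by (meson convex_ball has_field_derivative_at_within)
  then have "f x = g x" if "x \<in> ball a e" for x
    using that e(1) assms(3) by (metis centre_in_ball eq_iff_diff_eq_0)
  moreover have "\<forall>\<^sub>F x in nhds a. x \<in> ball a e"
    using e(1) by (intro eventually_nhds_in_open) auto
  ultimately show ?thesis by (auto elim: eventually_mono)
qed

text \<open>The compatibility condition of \<open>continuable_along\<close>, separated from the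
  initial germ and from analyticity and stated for any parameter set, so that pieces on subintervals
  can be glued.\<close>

definition continuation_on :: "real set \<Rightarrow> (real \<Rightarrow> complex) \<Rightarrow> (real \<Rightarrow> complex \<Rightarrow> complex) \<Rightarrow> bool" where
  "continuation_on I \<gamma> h \<longleftrightarrow>
     (\<forall>t\<in>I. \<forall>\<^sub>F t' in at t within I. \<forall>\<^sub>F x in nhds (\<gamma> t'). h t' x = h t x)"

lemma continuation_on_combine:
  assumes "continuation_on I \<gamma> h1" "continuation_on I \<gamma> h2"
  shows "continuation_on I \<gamma> (\<lambda>t x. g (h1 t x) (h2 t x))"
  unfolding continuation_on_def
proof
  fix t assume "t \<in> I"
  with assms have "\<forall>\<^sub>F t' in at t within I. \<forall>\<^sub>F x in nhds (\<gamma> t'). h1 t' x = h1 t x"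
    "\<forall>\<^sub>F t' in at t within I. \<forall>\<^sub>F x in nhds (\<gamma> t'). h2 t' x = h2 t x"
    by (auto simp: continuation_on_def)
  then show "\<forall>\<^sub>F t' in at t within I. \<forall>\<^sub>F x in nhds (\<gamma> t'). g (h1 t' x) (h2 t' x) = g (h1 t x) (h2 t x)"
  proof eventually_elim
    case (elim t')
    then show ?case by eventually_elim simp
  qed
qed

text \<open>Only \<open>b\<close> needs care: the glued family is \<open>H1 b\<close> there but
  \<open>H2\<close> to its right. The germs \<open>H1 b\<close> and \<open>H2 b\<close> agree near
  \<open>\<gamma> b\<close>, hence, by continuity of \<open>\<gamma>\<close>, near
  \<open>\<gamma> t'\<close> for all \<open>t'\<close> close to \<open>b\<close>.\<close>

lemma continuation_on_glue:
  assumes cont: "continuous_on {a..c} \<gamma>" and "a \<le> b" "b \<le> c"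
    and H1: "continuation_on {a..b} \<gamma> H1" and H2: "continuation_on {b..c} \<gamma> H2"
    and agree: "\<forall>\<^sub>F x in nhds (\<gamma> b). H2 b x = H1 b x"
  shows "continuation_on {a..c} \<gamma> (\<lambda>t. if t \<le> b then H1 t else H2 t)"
  unfolding continuation_on_def
proof
  let ?H = "\<lambda>t. if t \<le> b then H1 t else H2 t"
  fix t assume t: "t \<in> {a..c}"
  \<comment> \<open>The filter at \<open>t\<close> within \<open>{a..c}\<close> is the supremum of
    those within the two pieces; a piece that does not contain \<open>t\<close> contributes the
    trivial filter.\<close>
  have left: "\<forall>\<^sub>F t' in at t within {a..b}. \<forall>\<^sub>F x in nhds (\<gamma> t'). ?H t' x = ?H t x"
  proof (cases "t \<le> b")
    case True
    with H1 t have "\<forall>\<^sub>F t' in at t within {a..b}. \<forall>\<^sub>F x in nhds (\<gamma> t'). H1 t' x = H1 t x"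
      by (auto simp: continuation_on_def)
    moreover have "\<forall>\<^sub>F t' in at t within {a..b}. t' \<in> {a..b}"
      by (simp add: eventually_at_filter)
    ultimately show ?thesis by eventually_elim (use True in auto)
  next
    case False
    then have "at t within {a..b} = bot"
      by (intro at_within_eq_bot_iff[THEN iffD2]) (auto dest!: set_mp[OF closure_mono[of _ "{a..b}"]])
    then show ?thesis by simp
  qed
  have right: "\<forall>\<^sub>F t' in at t within {b..c}. \<forall>\<^sub>F x in nhds (\<gamma> t'). ?H t' x = ?H t x"
  proof (cases "t < b")
    case True
    then have "at t within {b..c} = bot"
      by (intro at_within_eq_bot_iff[THEN iffD2]) (auto dest!: set_mp[OF closure_mono[of _ "{b..c}"]])
    then show ?thesis by simp
  next
    case False
    with H2 t have ev: "\<forall>\<^sub>F t' in at t within {b..c}. \<forall>\<^sub>F x in nhds (\<gamma> t'). H2 t' x = H2 t x"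
      by (auto simp: continuation_on_def)
    have nb: "\<forall>\<^sub>F t' in at t within {b..c}. t' \<in> {b..c} \<and> t' \<noteq> t"
      by (simp add: eventually_at_filter)
    show ?thesis
    proof (cases "t = b")
      case False
      then have "\<forall>\<^sub>F t' in at t within {b..c}. b < t'"
        using \<open>\<not> t < b\<close> by (intro order_tendstoD(1)[OF tendsto_ident_at]) simp
      with ev show ?thesis by eventually_elim (use False \<open>\<not> t < b\<close> in auto)
    next
      case True
      have "(\<gamma> \<longlongrightarrow> \<gamma> b) (at b within {b..c})"
        using cont assms(2,3) by (meson atLeastAtMost_iff continuous_on continuous_on_subset
            atLeastatMost_subset_iff order_refl)
      then have "\<forall>\<^sub>F t' in at t within {b..c}. \<forall>\<^sub>F x in nhds (\<gamma> t'). H2 b x = H1 b x"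
        using eventually_eventually[THEN iffD2, OF agree] True
        unfolding filterlim_iff by blast
      with ev nb show ?thesis
      proof eventually_elim
        case (elim t')
        from elim(1,3) show ?case by eventually_elim (use True elim(2) in auto)
      qed
    qed
  qed
  have "{a..c} = {a..b} \<union> {b..c}" using assms(2,3) by auto
  then show "\<forall>\<^sub>F t' in at t within {a..c}. \<forall>\<^sub>F x in nhds (\<gamma> t'). ?H t' x = ?H t x"
    using left right by (simp add: at_within_union eventually_sup)
qed

text \<open>Primitives exist on discs around the points of the path, and on a disc two of them
  differ by a constant. Bisection by \<open>Bolzano\<close> reduces the choice of constants to short
  subintervals, where a single primitive suffices.\<close>

lemma continuation_antideriv:
  fixes \<gamma> :: "real \<Rightarrow> complex"
  assumes cont: "continuous_on {0..1} \<gamma>" and h: "continuation_on {0..1} \<gamma> h"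
    and hol: "\<And>t. t \<in> {0..1} \<Longrightarrow> h t analytic_on {\<gamma> t}"
    and F: "\<forall>\<^sub>F x in nhds (\<gamma> 0). (F has_field_derivative h 0 x) (at x)"
  obtains H where "\<forall>\<^sub>F x in nhds (\<gamma> 0). H 0 x = F x" "continuation_on {0..1} \<gamma> H"
    "\<And>t. t \<in> {0..1} \<Longrightarrow> \<forall>\<^sub>F x in nhds (\<gamma> t). (H t has_field_derivative h t x) (at x)"
proof -
  define ad where "ad K t \<longleftrightarrow> (\<forall>\<^sub>F x in nhds (\<gamma> t). (K has_field_derivative h t x) (at x))" for K t
  \<comment> \<open>Quantifying over every starting germ \<open>K\<close> makes \<open>P\<close>
    transitive: the final germ on one piece starts the next. The bounds sit in a premise because the
    short intervals of \<open>Bolzano\<close> may leave \<open>{0..1}\<close>.\<close>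
  define P where "P a b \<longleftrightarrow> (0 \<le> a \<and> b \<le> 1 \<longrightarrow> (\<forall>K. ad K a \<longrightarrow>
      (\<exists>H. (\<forall>\<^sub>F x in nhds (\<gamma> a). H a x = K x) \<and> continuation_on {a..b} \<gamma> H \<and>
           (\<forall>t\<in>{a..b}. ad (H t) t))))" for a b
  have "(0 :: real) \<le> 1" by simp
  then have "P 0 1"
  proof (induction rule: Bolzano)
    case (trans a b c)
    show ?case unfolding P_def
    proof safe
      fix K assume "0 \<le> a" "c \<le> 1" "ad K a"
      have bounds: "b \<le> 1" "0 \<le> b" "b \<in> {a..b}" using trans(3,4) \<open>0 \<le> a\<close> \<open>c \<le> 1\<close> by auto
      obtain H1 where H1: "\<forall>\<^sub>F x in nhds (\<gamma> a). H1 a x = K x"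
        "continuation_on {a..b} \<gamma> H1" "\<forall>t\<in>{a..b}. ad (H1 t) t"
        using trans(1)[unfolded P_def] \<open>0 \<le> a\<close> bounds(1) \<open>ad K a\<close> by blast
      then have "ad (H1 b) b" using bounds(3) by blast
      then obtain H2 where H2: "\<forall>\<^sub>F x in nhds (\<gamma> b). H2 b x = H1 b x"
        "continuation_on {b..c} \<gamma> H2" "\<forall>t\<in>{b..c}. ad (H2 t) t"
        using trans(2)[unfolded P_def] bounds(2) \<open>c \<le> 1\<close> by blast
      have "continuous_on {a..c} \<gamma>"
        by (rule continuous_on_subset[OF cont]) (use \<open>0 \<le> a\<close> \<open>c \<le> 1\<close> in auto)
      from continuation_on_glue[OF this trans(3,4) H1(2) H2(2) H2(1)]
      show "\<exists>H. (\<forall>\<^sub>F x in nhds (\<gamma> a). H a x = K x) \<and> continuation_on {a..c} \<gamma> H \<and>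
           (\<forall>t\<in>{a..c}. ad (H t) t)"
        by (rule_tac x = "\<lambda>t. if t \<le> b then H1 t else H2 t" in exI)
          (use H1 H2 trans(3,4) in simp)
    qed
  next
    case (local t)
    then have t: "t \<in> {0..1}" by simp
    obtain e where e: "e > 0" "h t holomorphic_on ball (\<gamma> t) e"
      using hol[OF t] by (auto simp: analytic_at_ball)
    then obtain G where "\<And>x. x \<in> ball (\<gamma> t) e \<Longrightarrow> (G has_field_derivative h t x) (at x within ball (\<gamma> t) e)"
      using holomorphic_convex_primitive'[of "ball (\<gamma> t) e" "h t"] by auto
    then have G: "(G has_field_derivative h t x) (at x)" if "x \<in> ball (\<gamma> t) e" for x
      using that by (metis at_within_open open_ball)
    have "(\<gamma> \<longlongrightarrow> \<gamma> t) (at t within {0..1})"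
      using cont t by (simp add: continuous_on)
    then have "\<forall>\<^sub>F t' in at t within {0..1}. \<gamma> t' \<in> ball (\<gamma> t) e"
      using e(1) by (intro topological_tendstoD) auto
    moreover have "\<forall>\<^sub>F t' in at t within {0..1}. \<forall>\<^sub>F x in nhds (\<gamma> t'). h t' x = h t x"
      using h t by (auto simp: continuation_on_def)
    ultimately have "\<forall>\<^sub>F t' in at t within {0..1}.
        \<gamma> t' \<in> ball (\<gamma> t) e \<and> (\<forall>\<^sub>F x in nhds (\<gamma> t'). h t' x = h t x)"
      by eventually_elim simp
    then obtain d where d: "d > 0" "\<And>t'. t' \<in> {0..1} \<Longrightarrow> t' \<noteq> t \<Longrightarrow> dist t' t < d \<Longrightarrow>
        \<gamma> t' \<in> ball (\<gamma> t) e \<and> (\<forall>\<^sub>F x in nhds (\<gamma> t'). h t' x = h t x)"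
      unfolding eventually_at by auto
    have near: "\<gamma> t' \<in> ball (\<gamma> t) e" "\<forall>\<^sub>F x in nhds (\<gamma> t'). h t' x = h t x"
      if "t' \<in> {0..1}" "dist t' t < d" for t'
      using d(2)[of t'] that e(1) by (cases "t' = t"; simp)+
    have adG: "\<forall>\<^sub>F x in nhds (\<gamma> t'). (G has_field_derivative h t' x) (at x)"
      if "t' \<in> {0..1}" "dist t' t < d" for t'
      using near(2)[OF that] eventually_nhds_in_open[OF open_ball near(1)[OF that]]
      by eventually_elim (simp add: G)
    have "P a b" if ab: "a \<le> t" "t \<le> b" "b - a < d" for a b
      unfolding P_def
    proof safe
      fix K assume "0 \<le> a" "b \<le> 1" and K: "ad K a"
      then have dist: "t' \<in> {0..1} \<and> dist t' t < d" if "t' \<in> {a..b}" for t'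
        using that ab by (auto simp: dist_real_def)
      have "a \<in> {a..b}" using ab by simp
      \<comment> \<open>With this constant \<open>G x + C\<close> agrees with \<open>K\<close> at
        \<open>\<gamma> a\<close>, hence near it. The family on the short interval can then be
        constant in its parameter.\<close>
      define C where "C = K (\<gamma> a) - G (\<gamma> a)"
      have adC: "ad (\<lambda>x. G x + C) t'" if "t' \<in> {a..b}" for t'
      proof -
        from dist[OF that] have "\<forall>\<^sub>F x in nhds (\<gamma> t'). (G has_field_derivative h t' x) (at x)"
          by (intro adG) auto
        then show ?thesis unfolding ad_def
          by eventually_elim (auto intro!: derivative_eq_intros)
      qed
      have "\<forall>\<^sub>F x in nhds (\<gamma> a). G x + C = K x"
        by (rule eventually_eq_if_same_deriv[OF adC[OF \<open>a \<in> {a..b}\<close>, unfolded ad_def] K[unfolded ad_def]])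
          (simp add: C_def)
      with adC show "\<exists>H. (\<forall>\<^sub>F x in nhds (\<gamma> a). H a x = K x) \<and> continuation_on {a..b} \<gamma> H \<and>
           (\<forall>t\<in>{a..b}. ad (H t) t)"
        by (intro exI[of _ "\<lambda>_ x. G x + C"]) (simp add: continuation_on_def)
    qed
    with d(1) show ?case by blast
  qed
  then obtain H where "\<forall>\<^sub>F x in nhds (\<gamma> 0). H 0 x = F x" "continuation_on {0..1} \<gamma> H"
    "\<forall>t\<in>{0..1}. ad (H t) t"
    using F unfolding P_def ad_def by auto
  then show thesis using that[of H] unfolding ad_def by blast
qed

lemma analytic_at_eventually_derivI:
  assumes "\<forall>\<^sub>F x in nhds a. (f has_field_derivative f' x) (at x)"
  shows "f analytic_on {a}"
  unfolding analytic_on_def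
proof
  fix x assume "x \<in> {a}"
  with assms obtain e where "e > 0" "\<And>y. y \<in> ball x e \<Longrightarrow> (f has_field_derivative f' y) (at y)"
    by (auto simp: eventually_nhds_metric dist_commute)
  then show "\<exists>e>0. f holomorphic_on ball x e"
    using holomorphic_on_derivI[of "ball x e" f f'] by blast
qed

lemma continuable_alongI:
  assumes "\<forall>\<^sub>F x in nhds (\<gamma> 0). h 0 x = f x"
    and "\<And>t. t \<in> {0..1} \<Longrightarrow> h t analytic_on {\<gamma> t}" and "continuation_on {0..1} \<gamma> h"
  shows "continuable_along f \<gamma>"
  using assms unfolding continuable_along_def continuation_on_def by blast

lemma continuable_alongE:
  assumes "continuable_along f \<gamma>"
  obtains h where "\<forall>\<^sub>F x in nhds (\<gamma> 0). h 0 x = f x"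
    "\<And>t. t \<in> {0..1} \<Longrightarrow> h t analytic_on {\<gamma> t}" "continuation_on {0..1} \<gamma> h"
  using assms unfolding continuable_along_def continuation_on_def by blast

text \<open>Induction for one fixed path. Quotients stay analytic because the path avoids all
  possible poles, sums and products are continued germ by germ, and antiderivatives by
  \<open>continuation_antideriv\<close>.\<close>

lemma iir_singular_only_at:
  assumes "iir \<nu> f"
  shows "singular_only_at (sing_points \<nu>) f"
  unfolding singular_only_at_def
proof safe
  fix \<gamma> :: "real \<Rightarrow> complex"
  assume "path \<gamma>" and start: "pathstart \<gamma> = 1" and avoid: "path_image \<gamma> \<inter> sing_points \<nu> = {}"
  then have cont: "continuous_on {0..1} \<gamma>" by (simp add: path_def)
  have [simp]: "\<gamma> 0 = 1" using start by (simp add: pathstart_def)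
  from assms show "continuable_along f \<gamma>"
  proof (induction rule: iir_induct)
    case (rat f)
    have poly_analytic: "poly p analytic_on {a}" for p :: "complex poly" and a
      by (rule analytic_at_eventually_derivI[OF always_eventually], rule allI, rule poly_DERIV)
    from rat obtain p q where q: "\<forall>x. poly q x = 0 \<longrightarrow> x \<in> sing_points \<nu>"
      and f: "\<forall>\<^sub>F x in nhds 1. f x = poly p x / poly q x"
      by (auto simp: rat_funs_def)
    show ?case
    proof (rule continuable_alongI[where h = "\<lambda>_ x. poly p x / poly q x"])
      show "\<forall>\<^sub>F x in nhds (\<gamma> 0). poly p x / poly q x = f x"
        using f by (simp add: eq_commute)
      fix t :: real assume "t \<in> {0..1}"
      then have "\<gamma> t \<notin> sing_points \<nu>" using avoid unfolding path_image_def by blast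
      with q show "(\<lambda>x. poly p x / poly q x) analytic_on {\<gamma> t}"
        by (intro analytic_on_divide poly_analytic) auto
    qed (simp add: continuation_on_def)
  next
    case (add f1 f2)
    obtain h1 where h1: "\<forall>\<^sub>F x in nhds (\<gamma> 0). h1 0 x = f1 x"
      "\<And>t. t \<in> {0..1} \<Longrightarrow> h1 t analytic_on {\<gamma> t}" "continuation_on {0..1} \<gamma> h1"
      using continuable_alongE[OF add.IH(1)] by blast
    obtain h2 where h2: "\<forall>\<^sub>F x in nhds (\<gamma> 0). h2 0 x = f2 x"
      "\<And>t. t \<in> {0..1} \<Longrightarrow> h2 t analytic_on {\<gamma> t}" "continuation_on {0..1} \<gamma> h2"
      using continuable_alongE[OF add.IH(2)] by blast
    show ?case
      by (rule continuable_alongI[where h = "\<lambda>t x. h1 t x + h2 t x"])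
        (use h1(2) h2(2) continuation_on_combine[where g = "(+)", OF h1(3) h2(3)]
           eventually_elim2[OF h1(1) h2(1)] in \<open>simp_all add: analytic_on_add\<close>)
  next
    case (mult f1 f2)
    obtain h1 where h1: "\<forall>\<^sub>F x in nhds (\<gamma> 0). h1 0 x = f1 x"
      "\<And>t. t \<in> {0..1} \<Longrightarrow> h1 t analytic_on {\<gamma> t}" "continuation_on {0..1} \<gamma> h1"
      using continuable_alongE[OF mult.IH(1)] by blast
    obtain h2 where h2: "\<forall>\<^sub>F x in nhds (\<gamma> 0). h2 0 x = f2 x"
      "\<And>t. t \<in> {0..1} \<Longrightarrow> h2 t analytic_on {\<gamma> t}" "continuation_on {0..1} \<gamma> h2"
      using continuable_alongE[OF mult.IH(2)] by blast
    show ?case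
      by (rule continuable_alongI[where h = "\<lambda>t x. h1 t x * h2 t x"])
        (use h1(2) h2(2) continuation_on_combine[where g = "(*)", OF h1(3) h2(3)]
           eventually_elim2[OF h1(1) h2(1)] in \<open>simp_all add: analytic_on_mult\<close>)
  next
    case (antideriv f F)
    obtain h where h: "\<forall>\<^sub>F x in nhds (\<gamma> 0). h 0 x = f x"
      "\<And>t. t \<in> {0..1} \<Longrightarrow> h t analytic_on {\<gamma> t}" "continuation_on {0..1} \<gamma> h"
      using continuable_alongE[OF antideriv.IH] by blast
    have "\<forall>\<^sub>F x in nhds (\<gamma> 0). (F has_field_derivative h 0 x) (at x)"
      using h(1) antideriv.hyps(2)[folded \<open>\<gamma> 0 = 1\<close>] by eventually_elim simp
    from continuation_antideriv[OF cont h(3,2) this] obtain H where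
      "\<forall>\<^sub>F x in nhds (\<gamma> 0). H 0 x = F x" "continuation_on {0..1} \<gamma> H"
      "\<And>t. t \<in> {0..1} \<Longrightarrow> \<forall>\<^sub>F x in nhds (\<gamma> t). (H t has_field_derivative h t x) (at x)" by blast
    then show ?case
      by (intro continuable_alongI[where h = H]) (auto intro: analytic_at_eventually_derivI)
  qed
qed

section \<open>Functions of the solution of the string equation\<close>

lemma analytic_at_eventually_deriv:
  assumes "f analytic_on {a}"
  shows "\<forall>\<^sub>F x in nhds a. (f has_field_derivative deriv f x) (at x)"
proof -
  from assms obtain S where "open S" "a \<in> S" "f holomorphic_on S"
    by (auto simp: analytic_at)
  then show ?thesis
    using eventually_nhds_in_open[of S a] by (auto elim!: eventually_mono intro: holomorphic_derivI)
qed

text \<open>With \<open>t = w ^ m * s\<close> the derivative is again a power of \<open>w\<close>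
  times a function of \<open>t\<close>, namely \<open>k U + m t U'\<close>. This shape lets the rule
  be iterated.\<close>

lemma DERIV_weighted:
  fixes w s :: complex
  assumes "w \<noteq> 0" "(U has_field_derivative U') (at (w ^ m * s))"
  shows "((\<lambda>w. w powi k * U (w ^ m * s)) has_field_derivative
           w powi (k - 1) * (of_int k * U (w ^ m * s) + of_nat m * ((w ^ m * s) * U'))) (at w)"
proof -
  have "((\<lambda>w. w ^ m * s) has_field_derivative of_nat m * w ^ (m - 1) * s) (at w)"
    by (auto intro!: derivative_eq_intros)
  from DERIV_chain2[of U, OF assms(2) this]
  have "((\<lambda>w. w powi k * U (w ^ m * s)) has_field_derivative
      w powi k * (U' * (of_nat m * w ^ (m - 1) * s)) + of_int k * w powi (k - 1) * U (w ^ m * s)) (at w)"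
    using assms(1) by (auto intro!: derivative_eq_intros)
  moreover have "w powi k * (U' * (of_nat m * w ^ (m - 1) * s)) =
      w powi (k - 1) * (of_nat m * ((w ^ m * s) * U'))"
    using assms(1) by (cases m) (simp_all add: power_int_diff)
  ultimately show ?thesis by (simp only: ring_distribs add.commute mult_ac)
qed

lemma isCont_tendsto_nhds: "isCont f a \<Longrightarrow> (f \<longlongrightarrow> f a) (nhds a)"
  by (simp add: isCont_def tendsto_at_iff_tendsto_nhds)

text \<open>\<open>y\<close> stands for \<open>z\<^sub>0\<close>.\<close>

locale string_solution =
  fixes \<nu> :: nat and y :: "complex \<Rightarrow> complex"
  assumes nu: "\<nu> \<ge> 2"
    and y_analytic: "y analytic_on {0}"
    and y_0: "y 0 = 1"
    and y_eq: "\<forall>\<^sub>F s in nhds 0. 1 = y s - c_const \<nu> * s * y s ^ \<nu>"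
begin

abbreviation D :: "complex \<Rightarrow> complex" where
  "D x \<equiv> of_nat \<nu> - of_nat (\<nu> - 1) * x"

lemma c_nonzero: "c_const \<nu> \<noteq> 0"
proof -
  have "2 * \<nu> * ((2 * \<nu> - 1) choose (\<nu> - 1)) \<noteq> 0"
    using nu by (simp add: binomial_eq_0_iff)
  then show ?thesis unfolding c_const_def of_nat_eq_0_iff .
qed

lemma D_1: "D 1 = 1"
  using nu by (simp add: of_nat_diff)

lemma y_tendsto: "(y \<longlongrightarrow> 1) (nhds 0)"
proof -
  from isCont_tendsto_nhds[OF analytic_at_imp_isCont[OF y_analytic]] show ?thesis
    unfolding y_0 .
qed

lemma eventually_comp_y:
  assumes "\<forall>\<^sub>F x in nhds 1. P x"
  shows "\<forall>\<^sub>F s in nhds 0. P (y s)"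
  using y_tendsto assms unfolding filterlim_iff by blast

lemma eventually_y_nonzero: "\<forall>\<^sub>F s in nhds 0. y s \<noteq> 0 \<and> D (y s) \<noteq> 0"
proof (rule eventually_comp_y, rule eventually_conj)
  show "\<forall>\<^sub>F x in nhds 1. x \<noteq> (0 :: complex)"
    by (rule t1_space_nhds) simp
  have "(D \<longlongrightarrow> D 1) (nhds 1)"
    by (intro isCont_tendsto_nhds continuous_intros)
  then show "\<forall>\<^sub>F x in nhds 1. D x \<noteq> 0"
    by (rule tendsto_imp_eventually_ne) (use D_1 in simp)
qed

lemma eventually_string_eq: "\<forall>\<^sub>F s in nhds 0. c_const \<nu> * s * y s ^ \<nu> = y s - 1"
  using y_eq by eventually_elim (simp add: algebra_simps)

lemma eventually_y_deriv:
  "\<forall>\<^sub>F s in nhds 0. (y has_field_derivative c_const \<nu> * y s ^ (\<nu> + 1) / D (y s)) (at s)"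
  using analytic_at_eventually_deriv[OF y_analytic] eventually_y_nonzero eventually_string_eq
    eventually_eventually[THEN iffD2, OF y_eq]
proof eventually_elim
  case (elim s)
  let ?c = "c_const \<nu>" and ?y' = "deriv y s"
  define Y where "Y = y s ^ (\<nu> - 1)"
  have pow: "y s ^ \<nu> = y s * Y"
    using nu unfolding Y_def by (metis Suc_diff_1 less_le_trans pos2 power_Suc)
  have "((\<lambda>s. y s - ?c * s * y s ^ \<nu>) has_field_derivative
      ?y' - (?c * y s ^ \<nu> + ?c * s * (of_nat \<nu> * y s ^ (\<nu> - 1) * ?y'))) (at s)"
    using elim(1) by (auto intro!: derivative_eq_intros simp: algebra_simps)
  moreover have "((\<lambda>s. y s - ?c * s * y s ^ \<nu>) has_field_derivative 0) (at s)"
    using DERIV_cong_ev[OF refl elim(4) refl, of 0] by simp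
  ultimately have "?y' - (?c * y s ^ \<nu> + ?c * s * (of_nat \<nu> * y s ^ (\<nu> - 1) * ?y')) = 0"
    by (rule DERIV_unique)
  \<comment> \<open>Multiplying by \<open>y s\<close> produces
    \<open>c_const \<nu> * s * y s ^ \<nu>\<close>, which the string equation turns into
    \<open>y s - 1\<close>. The coefficient of \<open>?y'\<close> becomes
    \<open>y s - \<nu> * (y s - 1)\<close>, that is \<open>D (y s)\<close>.\<close>
  then have "y s * ?y' - ?c * y s ^ (\<nu> + 1) - of_nat \<nu> * (?c * s * y s ^ \<nu>) * ?y' = 0"
    unfolding power_add power_one_right pow Y_def[symmetric] by algebra
  then have "?y' * D (y s) = ?c * y s ^ (\<nu> + 1)"
    using nu unfolding elim(3) by (simp add: of_nat_diff algebra_simps)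
  with elim(1,2) show ?case
    by (metis nonzero_mult_div_cancel_right)
qed

text \<open>Makes precise that a function of \<open>s\<close> depends on \<open>z\<^sub>0\<close>
  alone. Near \<open>s = 0\<close> the values of \<open>y\<close> are near 1, so it is the germ of
  \<open>\<Phi>\<close> at 1 that enters.\<close>

definition iir_in_y :: "(complex \<Rightarrow> complex) \<Rightarrow> bool" where
  "iir_in_y u \<longleftrightarrow> (\<exists>\<Phi>. iir \<nu> \<Phi> \<and> (\<forall>\<^sub>F s in nhds 0. u s = \<Phi> (y s)))"

lemma iir_in_yI: "iir \<nu> \<Phi> \<Longrightarrow> \<forall>\<^sub>F s in nhds 0. u s = \<Phi> (y s) \<Longrightarrow> iir_in_y u"
  unfolding iir_in_y_def by blast

lemma iir_in_yE:
  assumes "iir_in_y u"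
  obtains \<Phi> where "iir \<nu> \<Phi>" "\<forall>\<^sub>F s in nhds 0. u s = \<Phi> (y s)"
  using assms unfolding iir_in_y_def by blast

lemma iir_in_y_cong:
  assumes "iir_in_y u" "\<forall>\<^sub>F s in nhds 0. v s = u s"
  shows "iir_in_y v"
proof -
  obtain \<Phi> where \<Phi>: "iir \<nu> \<Phi>" "\<forall>\<^sub>F s in nhds 0. u s = \<Phi> (y s)"
    using iir_in_yE[OF assms(1)] .
  from \<Phi>(2) assms(2) have "\<forall>\<^sub>F s in nhds 0. v s = \<Phi> (y s)" by eventually_elim simp
  with \<Phi>(1) show ?thesis by (rule iir_in_yI)
qed

lemma iir_in_y_const: "iir_in_y (\<lambda>_. a)"
  by (rule iir_in_yI[OF iir_const[of _ a]]) simp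

lemma iir_in_y_add:
  assumes "iir_in_y u" "iir_in_y v"
  shows "iir_in_y (\<lambda>s. u s + v s)"
proof -
  obtain \<Phi> where \<Phi>: "iir \<nu> \<Phi>" "\<forall>\<^sub>F s in nhds 0. u s = \<Phi> (y s)"
    using iir_in_yE[OF assms(1)] .
  obtain \<Psi> where \<Psi>: "iir \<nu> \<Psi>" "\<forall>\<^sub>F s in nhds 0. v s = \<Psi> (y s)"
    using iir_in_yE[OF assms(2)] .
  from \<Phi>(2) \<Psi>(2) have "\<forall>\<^sub>F s in nhds 0. u s + v s = \<Phi> (y s) + \<Psi> (y s)"
    by eventually_elim simp
  with iir_add[OF \<Phi>(1) \<Psi>(1)] show ?thesis by (rule iir_in_yI)
qed

lemma iir_in_y_mult:
  assumes "iir_in_y u" "iir_in_y v"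
  shows "iir_in_y (\<lambda>s. u s * v s)"
proof -
  obtain \<Phi> where \<Phi>: "iir \<nu> \<Phi>" "\<forall>\<^sub>F s in nhds 0. u s = \<Phi> (y s)"
    using iir_in_yE[OF assms(1)] .
  obtain \<Psi> where \<Psi>: "iir \<nu> \<Psi>" "\<forall>\<^sub>F s in nhds 0. v s = \<Psi> (y s)"
    using iir_in_yE[OF assms(2)] .
  from \<Phi>(2) \<Psi>(2) have "\<forall>\<^sub>F s in nhds 0. u s * v s = \<Phi> (y s) * \<Psi> (y s)"
    by eventually_elim simp
  with iir_mult[OF \<Phi>(1) \<Psi>(1)] show ?thesis by (rule iir_in_yI)
qed

lemma iir_in_y_sum: "(\<And>i. i \<in> I \<Longrightarrow> iir_in_y (u i)) \<Longrightarrow> iir_in_y (\<lambda>s. \<Sum>i\<in>I. u i s)"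
  by (induction I rule: infinite_finite_induct) (simp_all add: iir_in_y_const iir_in_y_add)

lemma iir_in_y_prod: "(\<And>i. i \<in> I \<Longrightarrow> iir_in_y (u i)) \<Longrightarrow> iir_in_y (\<lambda>s. \<Prod>i\<in>I. u i s)"
  by (induction I rule: infinite_finite_induct) (simp_all add: iir_in_y_const iir_in_y_mult)

text \<open>\<open>s\<close> is the rational function \<open>(y - 1) / (c y\<^sup>\<nu>)\<close> of \<open>y\<close>, hence
  \<open>s d/ds = y (y - 1) / (\<nu> - (\<nu> - 1) y) d/dy\<close>.\<close>

lemma iir_in_y_euler:
  assumes "iir_in_y u"
  obtains u' where "iir_in_y (\<lambda>s. s * u' s)" "\<forall>\<^sub>F s in nhds 0. (u has_field_derivative u' s) (at s)"
proof -
  obtain \<Phi> where \<Phi>: "iir \<nu> \<Phi>" "\<forall>\<^sub>F s in nhds 0. u s = \<Phi> (y s)"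
    using iir_in_yE[OF assms] .
  obtain \<Phi>' where \<Phi>': "iir \<nu> \<Phi>'" "\<forall>\<^sub>F x in nhds 1. (\<Phi> has_field_derivative \<Phi>' x) (at x)"
    using iir_deriv[OF nu \<Phi>(1)] .
  define u' where "u' = (\<lambda>s. \<Phi>' (y s) * (c_const \<nu> * y s ^ (\<nu> + 1) / D (y s)))"
  have "\<forall>\<^sub>F s in nhds 0. (u has_field_derivative u' s) (at s)"
    using eventually_comp_y[OF \<Phi>'(2)] eventually_y_deriv eventually_eventually[THEN iffD2, OF \<Phi>(2)]
  proof eventually_elim
    case (elim s)
    from DERIV_chain2[OF elim(1,2)] show ?case
      unfolding u'_def DERIV_cong_ev[OF refl elim(3) refl] .
  qed
  moreover have "iir_in_y (\<lambda>s. s * u' s)"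
  proof (rule iir_in_yI)
    show "iir \<nu> (\<lambda>x. \<Phi>' x * (x * ((x + (-1)) * inverse (D x))))"
      by (intro iir_mult iir_add iir_const iir_ident iir_inverse_linear nu \<Phi>'(1))
    show "\<forall>\<^sub>F s in nhds 0. s * u' s = \<Phi>' (y s) * (y s * ((y s + (-1)) * inverse (D (y s))))"
      using eventually_string_eq
    proof eventually_elim
      case (elim s)
      \<comment> \<open>The explicit \<open>s\<close> combines with \<open>y s ^ \<nu>\<close> from
        the derivative of \<open>y\<close> into \<open>y s - 1\<close>, so that only
        \<open>y s\<close> remains.\<close>
      have "s * u' s = \<Phi>' (y s) * (y s * ((c_const \<nu> * s * y s ^ \<nu>) * inverse (D (y s))))"
        unfolding u'_def by (simp add: divide_inverse mult_ac)
      then show ?case unfolding elim by simp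
    qed
  qed
  ultimately show thesis using that by blast
qed

text \<open>On functions \<open>w\<^sup>k u(w\<^sup>\<nu>\<^sup>-\<^sup>1 s)\<close> the operator \<open>w \<partial>/\<partial>w\<close> acts as \<open>k + (\<nu> - 1) s d/ds\<close>
  does on \<open>u\<close>.\<close>

lemma weighted_higher_deriv:
  assumes "iir_in_y u"
  obtains v where "iir_in_y v"
    "\<forall>\<^sub>F s in nhds 0. \<forall>\<^sub>F w in nhds 1.
       (deriv ^^ n) (\<lambda>w. w powi k * u (w ^ (\<nu> - 1) * s)) w = w powi (k - int n) * v (w ^ (\<nu> - 1) * s)"
proof (induction n arbitrary: thesis)
  case 0
  show ?case by (rule 0[OF assms]) simp
next
  case (Suc n)
  \<comment> \<open>The formula is carried for all \<open>w\<close> near 1, not only at 1, since the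
    next derivative in \<open>w\<close> needs it on a neighbourhood.\<close>
  obtain v where v: "iir_in_y v" and deriv_n: "\<forall>\<^sub>F s in nhds 0. \<forall>\<^sub>F w in nhds 1.
      (deriv ^^ n) (\<lambda>w. w powi k * u (w ^ (\<nu> - 1) * s)) w = w powi (k - int n) * v (w ^ (\<nu> - 1) * s)"
    by (rule Suc.IH)
  obtain v' where v': "iir_in_y (\<lambda>s. s * v' s)" "\<forall>\<^sub>F s in nhds 0. (v has_field_derivative v' s) (at s)"
    using iir_in_y_euler[OF v] .
  define V where "V = (\<lambda>s. of_int (k - int n) * v s + of_nat (\<nu> - 1) * (s * v' s))"
  show ?case
  proof (rule Suc.prems)
    show "iir_in_y V"
      unfolding V_def by (intro iir_in_y_add iir_in_y_mult iir_in_y_const v v'(1))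
    show "\<forall>\<^sub>F s in nhds 0. \<forall>\<^sub>F w in nhds 1.
      (deriv ^^ Suc n) (\<lambda>w. w powi k * u (w ^ (\<nu> - 1) * s)) w =
        w powi (k - int (Suc n)) * V (w ^ (\<nu> - 1) * s)"
      using deriv_n eventually_eventually[THEN iffD2, OF v'(2)]
    proof eventually_elim
      case (elim s)
      \<comment> \<open>For fixed \<open>s\<close> near 0 the argument of \<open>v\<close> tends to
        \<open>s\<close> as \<open>w\<close> tends to 1, so \<open>v\<close> is differentiable at
        that argument.\<close>
      have "((\<lambda>w. w ^ (\<nu> - 1) * s) \<longlongrightarrow> 1 ^ (\<nu> - 1) * s) (nhds 1)"
        by (intro isCont_tendsto_nhds continuous_intros)
      then have "((\<lambda>w. w ^ (\<nu> - 1) * s) \<longlongrightarrow> s) (nhds 1)" by simp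
      with elim(2) have "\<forall>\<^sub>F w in nhds 1.
          (v has_field_derivative v' (w ^ (\<nu> - 1) * s)) (at (w ^ (\<nu> - 1) * s))"
        unfolding filterlim_iff by blast
      moreover have "\<forall>\<^sub>F w in nhds 1. w \<noteq> (0 :: complex)"
        by (rule t1_space_nhds) simp
      ultimately show ?case
        using eventually_eventually[THEN iffD2, OF elim(1)]
      proof eventually_elim
        case (elim w)
        have "(deriv ^^ Suc n) (\<lambda>w. w powi k * u (w ^ (\<nu> - 1) * s)) w =
            deriv (\<lambda>w. w powi (k - int n) * v (w ^ (\<nu> - 1) * s)) w"
          using deriv_cong_ev[OF elim(3) refl] by simp
        also have "\<dots> = w powi (k - int n - 1) * V (w ^ (\<nu> - 1) * s)"
          unfolding V_def by (rule DERIV_imp_deriv, rule DERIV_weighted[OF elim(2,1)])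
        finally show ?case by (simp add: algebra_simps)
      qed
    qed
  qed
qed

lemma iir_in_y_weighted_higher_deriv:
  assumes "iir_in_y u"
  shows "iir_in_y (\<lambda>s. (deriv ^^ n) (\<lambda>w. w powi k * u (w ^ (\<nu> - 1) * s)) 1)"
proof -
  obtain v where v: "iir_in_y v"
    "\<forall>\<^sub>F s in nhds 0. \<forall>\<^sub>F w in nhds 1.
       (deriv ^^ n) (\<lambda>w. w powi k * u (w ^ (\<nu> - 1) * s)) w = w powi (k - int n) * v (w ^ (\<nu> - 1) * s)"
    using weighted_higher_deriv[OF assms] .
  from v(2) have "\<forall>\<^sub>F s in nhds 0. (deriv ^^ n) (\<lambda>w. w powi k * u (w ^ (\<nu> - 1) * s)) 1 = v s"
    by eventually_elim (auto dest!: eventually_nhds_x_imp_x)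
  with v(1) show ?thesis by (rule iir_in_y_cong)
qed

section \<open>The forcing terms\<close>

lemma f_coeff_iir:
  assumes "iir_in_y (z r)"
  shows "iir_in_y (\<lambda>s. (deriv ^^ n) (f_coeff \<nu> z r s) 1)"
  using iir_in_y_weighted_higher_deriv[OF assms, of n "1 - 2 * int r"]
  unfolding f_coeff_def .

text \<open>The outer series is in \<epsilon>, the inner one in \<open>k\<^sup>-\<^sup>2\<close>.
  All orders in \<epsilon> are covered, but only inner orders below \<open>g\<close>, so that
  knowledge of \<open>z r\<close> for \<open>r < g\<close> suffices.\<close>

definition iir_coeffs_below :: "nat \<Rightarrow> (complex \<Rightarrow> complex fps fps) \<Rightarrow> bool" where
  "iir_coeffs_below g P \<longleftrightarrow> (\<forall>n. \<forall>r<g. iir_in_y (\<lambda>s. fps_nth (fps_nth (P s) n) r))"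

lemma iir_coeffs_below_1: "iir_coeffs_below g (\<lambda>_. 1)"
  by (simp add: iir_coeffs_below_def iir_in_y_const)

lemma iir_coeffs_below_diff:
  assumes "iir_coeffs_below g P" "iir_coeffs_below g Q"
  shows "iir_coeffs_below g (\<lambda>s. P s - Q s)"
  unfolding iir_coeffs_below_def
proof safe
  fix n r assume "r < g"
  then have "iir_in_y (\<lambda>s. fps_nth (fps_nth (P s) n) r + (-1) * fps_nth (fps_nth (Q s) n) r)"
    using assms unfolding iir_coeffs_below_def
    by (intro iir_in_y_add iir_in_y_mult iir_in_y_const) blast+
  then show "iir_in_y (\<lambda>s. fps_nth (fps_nth (P s - Q s) n) r)" by simp
qed

text \<open>A coefficient of order \<open>r\<close> in a Cauchy product uses only orders at most
  \<open>r\<close>, so the cut-off at \<open>g\<close> is respected.\<close>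

lemma iir_coeffs_below_mult:
  assumes "iir_coeffs_below g P" "iir_coeffs_below g Q"
  shows "iir_coeffs_below g (\<lambda>s. P s * Q s)"
  unfolding iir_coeffs_below_def fps_mult_nth fps_sum_nth
  using assms unfolding iir_coeffs_below_def
  by (intro allI impI iir_in_y_sum iir_in_y_mult) auto

lemma iir_coeffs_below_prod:
  "(\<And>i. i \<in> I \<Longrightarrow> iir_coeffs_below g (P i)) \<Longrightarrow> iir_coeffs_below g (\<lambda>s. \<Prod>i\<in>I. P i s)"
  by (induction I rule: infinite_finite_induct) (simp_all add: iir_coeffs_below_1 iir_coeffs_below_mult)

lemma iir_coeffs_below_sum:
  "(\<And>i. i \<in> I \<Longrightarrow> iir_coeffs_below g (P i)) \<Longrightarrow> iir_coeffs_below g (\<lambda>s. \<Sum>i\<in>I. P i s)"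
  unfolding iir_coeffs_below_def fps_sum_nth by (intro allI impI iir_in_y_sum) blast

lemma iir_coeffs_below_taylor_shift:
  assumes "\<And>r. r < g \<Longrightarrow> iir_in_y (z r)"
  shows "iir_coeffs_below g (\<lambda>s. taylor_shift (f_jet \<nu> z s 1) a)"
  unfolding iir_coeffs_below_def taylor_shift_def f_jet_def fps_nth_Abs_fps fps_mult_left_const_nth
  by (intro allI impI iir_in_y_mult iir_in_y_const f_coeff_iir assms)

lemma iir_in_y_F_coeff:
  assumes "\<And>r. r < g \<Longrightarrow> iir_in_y (z r)" "r < g"
  shows "iir_in_y (\<lambda>s. F_coeff \<nu> z l r s 1)"
proof -
  have "iir_coeffs_below g (\<lambda>s. \<Sum>j\<in>walk_indices \<nu>.
        (\<Prod>m = 1..\<nu> + 1. taylor_shift (f_jet \<nu> z s 1) (walk_level j m + 1))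
      - (\<Prod>m = 1..\<nu> + 1. taylor_shift (f_jet \<nu> z s 1) (walk_level j m)))"
    by (intro iir_coeffs_below_sum iir_coeffs_below_diff iir_coeffs_below_prod
        iir_coeffs_below_taylor_shift assms(1))
  with assms(2) show ?thesis
    unfolding iir_coeffs_below_def F_coeff_def F_poly_def by blast
qed

text \<open>Each product carries the power of \<open>w\<close> whose exponent is the sum of
  \<open>1 - 2 * int (i m)\<close>. As the indices sum to \<open>g\<close>, this is
  \<open>\<nu> + 1 - 2 * g\<close> for every tuple, so the whole sum has the weighted form whose
  derivatives are already controlled.\<close>

lemma iir_in_y_nonlinear_forcing:
  assumes "\<And>r. r < g \<Longrightarrow> iir_in_y (z r)"
  shows "iir_in_y (\<lambda>s. deriv (\<lambda>w. \<Sum>i\<in>lower_indices \<nu> g. \<Prod>m = 1..\<nu> + 1. f_coeff \<nu> z (i m) s w) 1)"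
proof -
  define k where "k = int (\<nu> + 1) - 2 * int g"
  define u where "u = (\<lambda>t. \<Sum>i\<in>lower_indices \<nu> g. \<Prod>m = 1..\<nu> + 1. z (i m) t)"
  have "iir_in_y u"
    unfolding u_def
  proof (intro iir_in_y_sum iir_in_y_prod assms)
    fix i m assume "i \<in> lower_indices \<nu> g" "m \<in> {1..\<nu> + 1}"
    then show "i m < g" by (auto simp: lower_indices_def PiE_iff)
  qed
  from iir_in_y_weighted_higher_deriv[OF this, of 1 k]
  have "iir_in_y (\<lambda>s. deriv (\<lambda>w. w powi k * u (w ^ (\<nu> - 1) * s)) 1)" by simp
  moreover have "deriv (\<lambda>w. \<Sum>i\<in>lower_indices \<nu> g. \<Prod>m = 1..\<nu> + 1. f_coeff \<nu> z (i m) s w) 1 =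
      deriv (\<lambda>w. w powi k * u (w ^ (\<nu> - 1) * s)) 1" for s
  proof (rule deriv_cong_ev[OF _ refl])
    have "\<forall>\<^sub>F w in nhds 1. w \<noteq> (0 :: complex)"
      by (rule t1_space_nhds) simp
    then show "\<forall>\<^sub>F w in nhds 1. (\<Sum>i\<in>lower_indices \<nu> g. \<Prod>m = 1..\<nu> + 1. f_coeff \<nu> z (i m) s w) =
      w powi k * u (w ^ (\<nu> - 1) * s)"
    proof eventually_elim
      case (elim w)
      have "(\<Prod>m = 1..\<nu> + 1. f_coeff \<nu> z (i m) s w) =
          w powi k * (\<Prod>m = 1..\<nu> + 1. z (i m) (w ^ (\<nu> - 1) * s))"
        if "i \<in> lower_indices \<nu> g" for i
      proof -
        have "(\<Prod>m\<in>M. w powi e m) = w powi (\<Sum>m\<in>M. e m)" if "finite M" for M :: "nat set" and e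
          using that elim by (induction M) (simp_all add: power_int_add)
        moreover have "(\<Sum>m = 1..\<nu> + 1. 1 - 2 * int (i m)) = k"
          using that unfolding k_def lower_indices_def
          by (simp add: sum_subtractf flip: sum_distrib_left of_nat_sum)
        ultimately show ?thesis
          unfolding f_coeff_def prod.distrib by (metis finite_atLeastAtMost)
      qed
      then show ?case unfolding u_def sum_distrib_left by (intro sum.cong) auto
    qed
  qed
  ultimately show ?thesis by simp
qed

text \<open>The index \<open>l\<close> starts at 1, so \<open>F_coeff\<close> occurs only at orders
  \<open>g - l < g\<close>.\<close>

lemma iir_in_y_Forcing:
  assumes "\<And>r. r < g \<Longrightarrow> iir_in_y (z r)"
  shows "iir_in_y (\<lambda>s. Forcing \<nu> z g s 1)"
  unfolding Forcing_def
  by (intro iir_in_y_add iir_in_y_mult iir_in_y_const iir_in_y_sum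
      iir_in_y_nonlinear_forcing iir_in_y_F_coeff[of g] assms) auto

section \<open>Integrating the hierarchy\<close>

text \<open>The string equation expresses the coefficients of \<open>u\<close> and its derivative
  through \<open>y\<close>; with this factor all terms in \<open>u\<close> itself cancel and only
  the forcing remains.\<close>

lemma hierarchy_integrating_factor:
  assumes "u analytic_on {0}" and y: "z 0 = y" and u: "z g = u"
    and "\<forall>\<^sub>F s in nhds 0. hierarchy_eq \<nu> z g s"
  shows "\<forall>\<^sub>F s in nhds 0. ((\<lambda>s. u s * D (y s) * y s powi (2 * int g - 2))
           has_field_derivative y s powi (2 * int g - 2) * Forcing \<nu> z g s 1) (at s)"
  using assms(4) analytic_at_eventually_deriv[OF assms(1)] eventually_y_deriv
    eventually_y_nonzero eventually_string_eq
proof eventually_elim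
  case (elim s)
  let ?c = "c_const \<nu>" and ?n = "of_nat \<nu> :: complex" and ?F = "Forcing \<nu> z g s 1"
  let ?y' = "?c * y s ^ (\<nu> + 1) / D (y s)" and ?u' = "deriv u s"
  let ?a = "of_int (1 - 2 * int g) :: complex"
  have n1: "of_nat (\<nu> - 1) = ?n - 1" using nu by (simp add: of_nat_diff)
  have "(f_coeff \<nu> z 0 s has_field_derivative y s + (?n - 1) * (s * ?y')) (at 1)"
    using DERIV_weighted[of 1 y ?y' "\<nu> - 1" s 1] elim(3) unfolding f_coeff_def y n1[symmetric]
    by simp
  then have d0: "deriv (f_coeff \<nu> z 0 s) 1 = y s + (?n - 1) * (s * ?y')"
    by (rule DERIV_imp_deriv)
  have "(f_coeff \<nu> z g s has_field_derivative ?a * u s + (?n - 1) * (s * ?u')) (at 1)"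
    using DERIV_weighted[of 1 u ?u' "\<nu> - 1" s "1 - 2 * int g"] elim(2)
    unfolding f_coeff_def u n1[symmetric] by simp
  then have dg: "deriv (f_coeff \<nu> z g s) 1 = ?a * u s + (?n - 1) * (s * ?u')"
    by (rule DERIV_imp_deriv)
  have f: "f_coeff \<nu> z 0 s 1 = y s" "f_coeff \<nu> z g s 1 = u s"
    by (simp_all add: f_coeff_def y u)
  have hier: "?u' = ?c * (y s ^ \<nu> * (?a * u s + (?n - 1) * (s * ?u'))
      + ?n * y s ^ (\<nu> - 1) * u s * (y s + (?n - 1) * (s * ?y'))) + ?F"
    using elim(1) unfolding hierarchy_eq_def d0 dg f u .
  define Y where "Y = y s ^ (\<nu> - 1)"
  have Y: "y s ^ \<nu> = y s * Y" "y s ^ (\<nu> + 1) = y s * y s * Y"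
    using nu unfolding Y_def by (cases \<nu>; simp)+
  define d where "d = D (y s)"
  have d: "d \<noteq> 0" "d = ?n - (?n - 1) * y s" "y s \<noteq> 0"
    using elim(4) unfolding d_def n1 by auto
  define q where "q = ?y'"
  have q: "q * d = ?c * (y s * y s * Y)"
    using d(1) unfolding q_def d_def[symmetric] Y by simp
  \<comment> \<open>The logarithmic derivative of \<open>y\<close>; \<open>d * p\<close> equals
    \<open>c_const \<nu> * y s ^ \<nu>\<close>.\<close>
  define p where "p = q / y s"
  have p: "d * p = ?c * (y s * Y)" "q = y s * p"
    using q d(3) unfolding p_def by (simp_all add: field_simps)
  have str: "?c * s * (y s * Y) = y s - 1"
    using elim(5) unfolding Y .
  \<comment> \<open>Collecting the terms in \<open>?u'\<close>: their coefficient is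
    \<open>1 - (\<nu> - 1) * (y s - 1)\<close>, which is \<open>d\<close>.\<close>
  have step1: "?c * (?n - 1) * s * (y s * Y) * ?u' = (?n - 1) * (y s - 1) * ?u'"
    unfolding str[symmetric] by (simp add: mult_ac)
  have "?u' * d = ?u' - ?c * (?n - 1) * s * (y s * Y) * ?u'"
    unfolding step1 d(2) by (simp add: algebra_simps)
  also have "\<dots> = ?c * (y s * Y) * ?a * u s + ?n * u s * ?c * Y * (y s + (?n - 1) * (s * q)) + ?F"
    using hier[folded q_def] unfolding Y(1) Y_def[symmetric] by algebra
  also have "\<dots> = ?c * (y s * Y) * ?a * u s + ?n * u s * (?c * Y * (y s + (?n - 1) * (s * q))) + ?F"
    by (simp add: mult_ac)
  \<comment> \<open>Multiplied by \<open>d\<close>, the left side contains the factor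
    \<open>d + (\<nu> - 1) * (y s - 1)\<close>, which is 1; so it collapses to
    \<open>p\<close>.\<close>
  also have "?c * Y * (y s + (?n - 1) * (s * q)) = p"
  proof -
    have "d * (?c * Y * (y s + (?n - 1) * (s * q))) = ?c * Y * (y s * d + (?n - 1) * s * (q * d))"
      by (simp add: algebra_simps)
    also have "\<dots> = ?c * Y * y s * (d + (?n - 1) * (?c * s * (y s * Y)))"
      unfolding q by algebra
    also have "\<dots> = ?c * (y s * Y)"
      unfolding str d(2) by (simp add: algebra_simps)
    finally show ?thesis
      unfolding p(1)[symmetric] mult_left_cancel[OF d(1)] .
  qed
  finally have step2: "?u' * d = d * p * ?a * u s + ?n * u s * p + ?F"
    unfolding p(1) .
  let ?e = "2 * int g - 2"
  have "((\<lambda>s. u s * D (y s) * y s powi ?e) has_field_derivative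
      (?u' * D (y s) - u s * ((?n - 1) * q)) * y s powi ?e
        + u s * D (y s) * (of_int ?e * y s powi (?e - 1) * q)) (at s)"
    unfolding n1[symmetric] using elim(2) elim(3)[folded q_def] d(3)
    by (auto intro!: derivative_eq_intros simp: algebra_simps)
  \<comment> \<open>Up to the common power of \<open>y s\<close>, the total coefficient of
    \<open>u s\<close> is \<open>(?a + ?e) * d * p + \<nu> * p - (\<nu> - 1) * y s * p\<close>. The
    exponent satisfies \<open>?e = - ?a - 1\<close>, which makes this zero.\<close>
  also have "(?u' * D (y s) - u s * ((?n - 1) * q)) * y s powi ?e
        + u s * D (y s) * (of_int ?e * y s powi (?e - 1) * q) = y s powi ?e * ?F"
  proof -
    have "y s powi (?e - 1) = y s powi ?e / y s"
      using power_int_diff[of "y s" ?e 1] d(3) unfolding power_int_1_right by blast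
    then have A: "u s * d * (of_int ?e * y s powi (?e - 1) * (y s * p)) = y s powi ?e * (of_int ?e * u s * d * p)"
      using d(3) by simp
    have E: "of_int ?e = - ?a - 1" by simp
    have "d * p = ?n * p - (?n - 1) * (y s * p)"
      unfolding d(2) by (simp add: algebra_simps)
    then have "d * p * ?a * u s + ?n * u s * p - u s * ((?n - 1) * (y s * p)) + (- ?a - 1) * u s * d * p = 0"
      by algebra
    then show ?thesis
      unfolding d_def[symmetric] p(2) A unfolding step2 E by algebra
  qed
  finally show ?case .
qed

text \<open>\<open>z g\<close> times the integrating factor and the primitive of the integrand,
  taken at \<open>y s\<close>, have the same derivative in \<open>s\<close> and the same value at
  \<open>s = 0\<close>. The result is both the induction step for class iir and the explicit
  formula.\<close>

lemma hierarchy_solution: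
  assumes analytic: "z g analytic_on {0}" and z_0: "z g 0 = 0" and y: "z 0 = y"
    and hier: "\<forall>\<^sub>F s in nhds 0. hierarchy_eq \<nu> z g s"
    and lower: "\<And>r. r < g \<Longrightarrow> iir_in_y (z r)"
  obtains Z \<Phi> where "iir \<nu> Z" "iir \<nu> \<Phi>"
    "\<forall>\<^sub>F s in nhds 0. z g s = Z (y s) \<and> Forcing \<nu> z g s 1 = \<Phi> (y s) \<and>
       (\<lambda>x. D x / (c_const \<nu> * x powi (int \<nu> + 3 - 2 * int g)) * \<Phi> x)
         contour_integrable_on linepath 1 (y s) \<and>
       z g s = y s powi (2 * (1 - int g)) / D (y s)
         * contour_integral (linepath 1 (y s))
             (\<lambda>x. D x / (c_const \<nu> * x powi (int \<nu> + 3 - 2 * int g)) * \<Phi> x)"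
proof -
  let ?c = "c_const \<nu>" and ?e = "int \<nu> + 3 - 2 * int g"
  obtain \<Phi> where \<Phi>: "iir \<nu> \<Phi>" "\<forall>\<^sub>F s in nhds 0. Forcing \<nu> z g s 1 = \<Phi> (y s)"
    using iir_in_yE[OF iir_in_y_Forcing[OF lower]] .
  define I where "I = (\<lambda>x. D x / (?c * x powi ?e) * \<Phi> x)"
  have iir_D: "iir \<nu> D"
    using iir_add[OF iir_const[of \<nu> "of_nat \<nu>"] iir_mult[OF iir_const[of \<nu> "- of_nat (\<nu> - 1)"] iir_ident]]
    by (simp del: of_nat_diff)
  have "I = (\<lambda>x. D x * (inverse ?c * x powi (- ?e)) * \<Phi> x)"
    unfolding I_def power_int_minus by (simp add: divide_inverse)
  then have "iir \<nu> I"
    using iir_mult[OF iir_mult[OF iir_D iir_mult[OF iir_const iir_power_int_ident]] \<Phi>(1)] by simp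
  then obtain F e where F: "iir \<nu> F" "e > 0" "F 1 = 0"
    "\<And>x. x \<in> ball 1 e \<Longrightarrow> (F has_field_derivative I x) (at x)"
    using iir_has_antideriv[OF nu] by metis
  define Z where "Z = (\<lambda>x. x powi (2 * (1 - int g)) * inverse (D x) * F x)"
  have "iir \<nu> Z"
    unfolding Z_def by (intro iir_mult iir_power_int_ident iir_inverse_linear nu F(1))
  define W where "W = (\<lambda>s. z g s * D (y s) * y s powi (2 * int g - 2))"
  have "\<forall>\<^sub>F x in nhds 1. x \<in> ball 1 e"
    using F(2) by (intro eventually_nhds_in_open) auto
  then have in_ball: "\<forall>\<^sub>F s in nhds 0. y s \<in> ball 1 e"
    by (rule eventually_comp_y)
  have "\<forall>\<^sub>F s in nhds 0. (W has_field_derivative y s powi (2 * int g - 2) * Forcing \<nu> z g s 1) (at s)"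
    unfolding W_def by (rule hierarchy_integrating_factor[OF analytic y refl hier])
  moreover have "\<forall>\<^sub>F s in nhds 0. ((\<lambda>s. F (y s)) has_field_derivative
      y s powi (2 * int g - 2) * Forcing \<nu> z g s 1) (at s)"
    using in_ball eventually_y_deriv eventually_y_nonzero \<Phi>(2)
  proof eventually_elim
    case (elim s)
    \<comment> \<open>The exponents \<open>2 g - 2\<close> and \<open>\<nu> + 3 - 2 g\<close> add up
      to \<open>\<nu> + 1\<close>, the power in the derivative of \<open>y\<close>;
      \<open>D (y s)\<close> and the constant cancel as well.\<close>
    have "y s powi (2 * int g - 2) * y s powi ?e = y s powi (int (\<nu> + 1))"
      using elim(3) by (simp flip: power_int_add)
    then have "I (y s) * (?c * y s ^ (\<nu> + 1) / D (y s)) = y s powi (2 * int g - 2) * Forcing \<nu> z g s 1"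
      using elim(3) c_nonzero unfolding I_def elim(4) power_int_of_nat
      by (simp add: field_simps del: of_nat_diff power_Suc power_add)
    with DERIV_chain2[OF F(4)[OF elim(1)] elim(2)] show ?case by simp
  qed
  \<comment> \<open>Both sides vanish, the left by \<open>z g 0 = 0\<close> and the right by
    \<open>y 0 = 1\<close> and \<open>F 1 = 0\<close>. This initial value selects the
    solution.\<close>
  moreover have "W 0 = F (y 0)"
    unfolding W_def z_0 y_0 F(3) by simp
  ultimately have "\<forall>\<^sub>F s in nhds 0. W s = F (y s)"
    by (rule eventually_eq_if_same_deriv)
  then have "\<forall>\<^sub>F s in nhds 0. z g s = Z (y s) \<and> Forcing \<nu> z g s 1 = \<Phi> (y s) \<and>
      I contour_integrable_on linepath 1 (y s) \<and>
      z g s = y s powi (2 * (1 - int g)) / D (y s) * contour_integral (linepath 1 (y s)) I"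
    using in_ball eventually_y_nonzero \<Phi>(2)
  proof eventually_elim
    case (elim s)
    have "y s powi (2 * (1 - int g)) = inverse (y s powi (2 * int g - 2))"
      by (simp add: algebra_simps flip: power_int_minus)
    then have "z g s = y s powi (2 * (1 - int g)) / D (y s) * F (y s)"
      using elim(3) unfolding elim(1)[symmetric] W_def by (simp add: field_simps del: of_nat_diff)
    \<comment> \<open>The segment from 1 to \<open>y s\<close> stays in the convex disc on which
      \<open>F\<close> is a primitive of \<open>I\<close>.\<close>
    moreover have "(I has_contour_integral F (y s) - F 1) (linepath 1 (y s))"
      using contour_integral_primitive[of "ball 1 e" F I "linepath 1 (y s)"] F(2,4) elim(2)
      by (simp add: has_field_derivative_at_within closed_segment_subset)
    ultimately show ?case
      using elim(4) unfolding Z_def F(3)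
      by (auto simp: has_contour_integral_integrable contour_integral_unique divide_inverse)
  qed
  with \<open>iir \<nu> Z\<close> \<Phi>(1) show thesis
    unfolding I_def by (rule that)
qed

end

section \<open>Strong induction along the hierarchy\<close>

theorem theorem2p3:
  fixes \<nu> g :: nat and r :: real
    and b :: "real \<Rightarrow> nat \<Rightarrow> real"
    and z :: "nat \<Rightarrow> complex \<Rightarrow> complex"
  assumes nu: "\<nu> \<ge> 2" and g: "g \<ge> 1"
    and b: "\<And>\<xi>. \<xi> \<le> 0 \<Longrightarrow> recurrence_coeffs \<nu> \<xi> (b \<xi>)"
    and r: "r > 0"
    and expansion: "\<And>s. s \<in> {-r<..0} \<Longrightarrow> has_expansion_at \<nu> b z s"
    and analytic: "\<And>h. z h analytic_on {0}"
    and z0_at_0: "z 0 0 = 1"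
    and zh_at_0: "\<And>h. h \<ge> 1 \<Longrightarrow> z h 0 = 0"
    and z0_eq: "\<forall>\<^sub>F s in nhds 0. 1 = z 0 s - c_const \<nu> * s * z 0 s ^ \<nu>"
    and hierarchy: "\<And>h. h \<ge> 1 \<Longrightarrow> \<forall>\<^sub>F s in nhds 0. hierarchy_eq \<nu> z h s"
  shows "\<exists>Z \<Phi> :: complex \<Rightarrow> complex.
           iir \<nu> Z \<and> singular_only_at (sing_points \<nu>) Z \<and> iir \<nu> \<Phi> \<and>
           (\<forall>\<^sub>F s in nhds 0.
              z g s = Z (z 0 s) \<and>
              Forcing \<nu> z g s 1 = \<Phi> (z 0 s) \<and>
              (\<lambda>y. (of_nat \<nu> - of_nat (\<nu> - 1) * y) / (c_const \<nu> * y powi (int \<nu> + 3 - 2 * int g)) * \<Phi> y)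
                contour_integrable_on linepath 1 (z 0 s) \<and>
              z g s = z 0 s powi (2 * (1 - int g)) / (of_nat \<nu> - of_nat (\<nu> - 1) * z 0 s)
                * contour_integral (linepath 1 (z 0 s))
                    (\<lambda>y. (of_nat \<nu> - of_nat (\<nu> - 1) * y) / (c_const \<nu> * y powi (int \<nu> + 3 - 2 * int g)) * \<Phi> y))"
proof -
  interpret string_solution \<nu> "z 0"
    by unfold_locales (rule nu analytic z0_at_0 z0_eq)+
  \<comment> \<open>\<open>z 0\<close> is the identity function of itself; for
    \<open>h \<ge> 1\<close> the equation for \<open>z h\<close> is solved once all lower
    coefficients are known to be functions of \<open>z 0\<close> of class iir.\<close>
  have iir_z: "iir_in_y (z h)" for h
  proof (induction h rule: less_induct)
    case (less h)
    show ?case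
    proof (cases "h = 0")
      case True
      then show ?thesis using iir_in_yI[OF iir_ident, of "z 0"] by simp
    next
      case False
      then have "h \<ge> 1" by simp
      obtain Z \<Phi> where Z: "iir \<nu> Z" "\<forall>\<^sub>F s in nhds 0. z h s = Z (z 0 s)"
        using hierarchy_solution[OF analytic zh_at_0[OF \<open>h \<ge> 1\<close>] refl hierarchy[OF \<open>h \<ge> 1\<close>] less]
        unfolding eventually_conj_iff by metis
      then show ?thesis by (rule iir_in_yI)
    qed
  qed
  \<comment> \<open>The witnesses are those of \<open>hierarchy_solution\<close>; the claim on
    singularities follows from membership of \<open>Z\<close> in the class.\<close>
  show ?thesis
    by (rule hierarchy_solution[OF analytic zh_at_0[OF g] refl hierarchy[OF g] iir_z])
      (intro exI conjI; (assumption | rule iir_singular_only_at, assumption))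
qed

end
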